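(* Let $X,Y$ be Banach spaces, let $D\subset X$ be non-empty, and let $F\colon D\to Y$ be an injective, continuous map whose inverse $F^{-1}\colon F(D)\to D$ is discontinuous. Let $f^\dagger\in D$. Suppose there exist a family of seminorms $p_n\colon X\to[0,\infty)$, $n\in\mathbb{N}_0$, and an increasing sequence $(\nu_n)_{n\in\mathbb{N}_0}$ of positive real numbers such that: (1) $p_n^\perp:=\|\cdot\|_X-p_n$ is a seminorm on $X$ for all $n\in\mathbb{N}_0$; (2) $\lim_{n\to\infty}p_n(f^\dagger)=\|f^\dagger\|_X$; (3) $p_n(f_1-f_2)\le\nu_n\|F(f_1)-F(f_2)\|_Y$ for all $f_1,f_2\in D$ and $n\in\mathbb{N}_0$. Define $$\varphi(t):=2\inf_{n\in\mathbb{N}}\left(\nu_n\sqrt t+p_n^\perp(f^\dagger)\right),\qquad t\ge0.$$ Then $\varphi$ is an index function and $f^\dagger$ satisfies the variational source condition $$\|f-f^\dagger\|_X\le\|f\|_X-\|f^\dagger\|_X+\varphi\left(\|F(f)-F(f^\dagger)\|_Y^2\right)\qquad\text{for all }f\in D.$$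
   Context: An index function is a continuous and strictly increasing function $\varphi\colon[0,\infty)\to[0,\infty)$ with $\varphi(0)=0$. $\mathbb{N}=\{1,2,\dots\}$ and $\mathbb{N}_0=\mathbb{N}\cup\{0\}$. *)

theory Defs
  imports "HOL-Analysis.Analysis"
begin

definition seminorm :: "('a::real_vector \<Rightarrow> real) \<Rightarrow> bool" where
  "seminorm p \<longleftrightarrow>
     (\<forall>x. 0 \<le> p x) \<and>
     (\<forall>c x. p (c *\<^sub>R x) = \<bar>c\<bar> * p x) \<and>
     (\<forall>x y. p (x + y) \<le> p x + p y)"

(* Only the restriction to [0, \<infinity>) matters; values at negative arguments are unconstrained. *)
definition index_function :: "(real \<Rightarrow> real) \<Rightarrow> bool" where
  "index_function \<phi> \<longleftrightarrow>
     \<phi> ` {0..} \<subseteq> {0..} \<and> continuous_on {0..} \<phi> \<and> strict_mono_on {0..} \<phi> \<and> \<phi> 0 = 0"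

definition variational_source_condition ::
  "'a::real_normed_vector set \<Rightarrow> ('a \<Rightarrow> 'b::real_normed_vector) \<Rightarrow> (real \<Rightarrow> real) \<Rightarrow> 'a \<Rightarrow> bool" where
  "variational_source_condition D F \<phi> f' \<longleftrightarrow>
     (\<forall>f\<in>D. norm (f - f') \<le> norm f - norm f' + \<phi> ((norm (F f - F f'))\<^sup>2))"

definition compl_seminorm :: "('a::real_normed_vector \<Rightarrow> real) \<Rightarrow> 'a \<Rightarrow> real" where
  "compl_seminorm p x = norm x - p x"

end

(* The infimum g(s) of the affine functions nu_n s + a_n, with slopes bounded below by some c > 0
   and intercepts a_n >= 0 of infimum 0, satisfies g(t) >= g(s) + c (t - s) for s <= t, which gives
   strict monotonicity, and g(k s) <= k g(s) for k >= 1, which squeezes g near every s > 0; near 0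
   it is squeezed by any single nu_n s + a_n. Now phi(t) = 2 g(sqrt t) with a_n = p_n^perp(f_dag).
   The source condition comes from splitting the norm of f - f_dag into p_n + p_n^perp and bounding
   p_n^perp(f) = |f| - p_n(f) by |f| - |f_dag| + p_n^perp(f_dag) + p_n(f - f_dag). *)
theory Submission
  imports Defs
begin

section \<open>Infima of families of affine functions\<close>

lemma bdd_below_affine_family:
  fixes \<nu> a :: "'i \<Rightarrow> real"
  assumes "\<And>n. n \<in> A \<Longrightarrow> 0 \<le> \<nu> n" "\<And>n. n \<in> A \<Longrightarrow> 0 \<le> a n" "0 \<le> s"
  shows "bdd_below ((\<lambda>n. \<nu> n * s + a n) ` A)"
  using assms by (intro bdd_belowI2[where m = 0]) simp

text \<open>From s to t every member of the family gains at least c * (t - s), and a gain that is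
  uniform in n survives the infimum. A bare infimum of strictly increasing functions could lose
  strictness; the common slope bound c keeps it.\<close>

lemma INF_affine_increment:
  fixes \<nu> a :: "'i \<Rightarrow> real"
  assumes "A \<noteq> {}" "0 \<le> c"
    and "\<And>n. n \<in> A \<Longrightarrow> c \<le> \<nu> n" "\<And>n. n \<in> A \<Longrightarrow> 0 \<le> a n"
    and "0 \<le> s" "s \<le> t"
  shows "(INF n\<in>A. \<nu> n * s + a n) + c * (t - s) \<le> (INF n\<in>A. \<nu> n * t + a n)"
proof (rule cINF_greatest)
  fix n assume n: "n \<in> A"
  have "bdd_below ((\<lambda>n. \<nu> n * s + a n) ` A)"
    using assms by (intro bdd_below_affine_family) (auto intro: order_trans)
  then have "(INF n\<in>A. \<nu> n * s + a n) \<le> \<nu> n * s + a n"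
    using n by (rule cINF_lower)
  moreover have "c * (t - s) \<le> \<nu> n * (t - s)"
    using assms n by (intro mult_right_mono) auto
  ultimately show "(INF n\<in>A. \<nu> n * s + a n) + c * (t - s) \<le> \<nu> n * t + a n"
    by (simp add: algebra_simps)
qed fact

text \<open>Multiplying \<nu> t + a by s / t \<le> 1 turns the linear part into exactly \<nu> s,
  while the intercept a \<ge> 0 can only shrink. This is the part of concavity that continuity away
  from 0 needs.\<close>

lemma INF_affine_scale:
  fixes \<nu> a :: "'i \<Rightarrow> real"
  assumes "A \<noteq> {}"
    and "\<And>n. n \<in> A \<Longrightarrow> 0 \<le> \<nu> n" "\<And>n. n \<in> A \<Longrightarrow> 0 \<le> a n"
    and "0 < s" "s \<le> t"
  shows "(s / t) * (INF n\<in>A. \<nu> n * t + a n) \<le> (INF n\<in>A. \<nu> n * s + a n)"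
proof (rule cINF_greatest)
  fix n assume n: "n \<in> A"
  have "bdd_below ((\<lambda>n. \<nu> n * t + a n) ` A)"
    using assms by (intro bdd_below_affine_family) auto
  then have "(INF n\<in>A. \<nu> n * t + a n) \<le> \<nu> n * t + a n"
    using n by (rule cINF_lower)
  then have "(s / t) * (INF n\<in>A. \<nu> n * t + a n) \<le> (s / t) * (\<nu> n * t + a n)"
    using assms by (intro mult_left_mono) auto
  also have "\<dots> = \<nu> n * s + (s / t) * a n"
    using assms by (simp add: field_simps)
  also have "\<dots> \<le> \<nu> n * s + a n"
    using assms n by (intro add_left_mono mult_left_le_one_le) auto
  finally show "(s / t) * (INF n\<in>A. \<nu> n * t + a n) \<le> \<nu> n * s + a n" .
qed fact

lemma index_function_INF_affine:
  fixes \<nu> a :: "'i \<Rightarrow> real"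
  assumes "0 < c"
    and slope: "\<And>n. n \<in> A \<Longrightarrow> c \<le> \<nu> n"
    and nonneg: "\<And>n. n \<in> A \<Longrightarrow> 0 \<le> a n"
    and small: "\<And>e. 0 < e \<Longrightarrow> \<exists>n\<in>A. a n < e"
  shows "index_function (\<lambda>s. INF n\<in>A. \<nu> n * s + a n)" (is "index_function ?g")
proof -
  have ne: "A \<noteq> {}"
    using small[of 1] by auto
  have slope0: "0 \<le> \<nu> n" if "n \<in> A" for n
    using slope[OF that] \<open>0 < c\<close> by linarith
  have lower: "?g s \<le> \<nu> n * s + a n" if "n \<in> A" "0 \<le> s" for n s
    using that slope0 nonneg by (intro cINF_lower bdd_below_affine_family)
  have g_nonneg: "0 \<le> ?g s" if "0 \<le> s" for s
    using that slope0 nonneg by (intro cINF_greatest ne) simp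
  have incr: "?g s + c * (t - s) \<le> ?g t" if "0 \<le> s" "s \<le> t" for s t
    using that \<open>0 < c\<close> slope nonneg by (intro INF_affine_increment ne) auto
  have mono: "?g s \<le> ?g t" if "0 \<le> s" "s \<le> t" for s t
    using incr[OF that] that \<open>0 < c\<close> by (smt (verit) mult_nonneg_nonneg)
  \<comment> \<open>At 0 the slopes drop out, so only the infimum of the intercepts remains.\<close>
  have zero: "?g 0 = 0"
  proof (rule antisym)
    show "?g 0 \<le> 0"
    proof (rule field_le_epsilon)
      fix e :: real assume "0 < e"
      then obtain n where "n \<in> A" "a n < e"
        using small by blast
      then show "?g 0 \<le> 0 + e"
        using lower[of n 0] by simp
    qed
  qed (rule g_nonneg, simp)
  have cont: "(?g \<longlongrightarrow> ?g s) (at s within {0..})" if "0 \<le> s" for s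
  proof (cases "s = 0")
    case True
    have "(?g \<longlongrightarrow> 0) (at 0 within {0..})"
    proof (rule tendstoI)
      fix e :: real assume "0 < e"
      then obtain n where n: "n \<in> A" "a n < e"
        using small by blast
      \<comment> \<open>One member with intercept below e suffices: it majorizes the infimum and, by
        continuity, stays below e near 0.\<close>
      have "((\<lambda>t. \<nu> n * t + a n) \<longlongrightarrow> \<nu> n * 0 + a n) (at 0 within {0..})"
        by (intro tendsto_intros)
      then have "\<forall>\<^sub>F t in at 0 within {0..}. \<nu> n * t + a n < e"
        using n by (intro order_tendstoD) auto
      moreover have "\<forall>\<^sub>F t in at 0 within {0..}. t \<in> {0::real..}"
        by (simp add: eventually_at_filter)
      ultimately show "\<forall>\<^sub>F t in at 0 within {0..}. dist (?g t) 0 < e"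
      proof eventually_elim
        case (elim t)
        then show ?case
          using lower[OF n(1), of t] g_nonneg[of t] by (simp add: dist_real_def)
      qed
    qed
    then show ?thesis
      using True zero by simp
  next
    case False
    with that have "0 < s" by simp
    \<comment> \<open>The factors min 1 (t / s) and max 1 (t / s) merge the cases t \<le> s and t
      \<ge> s into one pair of envelopes. Both factors tend to 1 at s, so no one-sided limits are
      needed.\<close>
    have "((\<lambda>t. min 1 (t / s) * ?g s) \<longlongrightarrow> min 1 (s / s) * ?g s) (at s within {0..})"
      by (intro tendsto_intros) (use \<open>0 < s\<close> in auto)
    then have lo: "((\<lambda>t. min 1 (t / s) * ?g s) \<longlongrightarrow> ?g s) (at s within {0..})"
      using \<open>0 < s\<close> by simp
    have "((\<lambda>t. max 1 (t / s) * ?g s) \<longlongrightarrow> max 1 (s / s) * ?g s) (at s within {0..})"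
      by (intro tendsto_intros) (use \<open>0 < s\<close> in auto)
    then have hi: "((\<lambda>t. max 1 (t / s) * ?g s) \<longlongrightarrow> ?g s) (at s within {0..})"
      using \<open>0 < s\<close> by simp
    have bounds: "min 1 (t / s) * ?g s \<le> ?g t \<and> ?g t \<le> max 1 (t / s) * ?g s" if "0 < t" for t
    \<comment> \<open>To the right of s, monotonicity gives the lower envelope and scaling the upper
      one; to the left they swap roles.\<close>
    proof (cases "s \<le> t")
      case True
      then have "(s / t) * ?g t \<le> ?g s"
        using \<open>0 < s\<close> slope0 nonneg by (intro INF_affine_scale ne)
      then have "?g t \<le> (t / s) * ?g s"
        using \<open>0 < s\<close> \<open>0 < t\<close> by (simp add: field_simps)
      then show ?thesis
        using True \<open>0 < s\<close> mono[of s t] by (simp add: min_def max_def)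
    next
      case False
      then have "(t / s) * ?g s \<le> ?g t"
        using \<open>0 < t\<close> slope0 nonneg by (intro INF_affine_scale ne) auto
      then show ?thesis
        using False \<open>0 < s\<close> \<open>0 < t\<close> mono[of t s] by (simp add: min_def max_def)
    qed
    \<comment> \<open>The scaling estimate requires the smaller of the two points to be positive,
      which holds near s > 0.\<close>
    have "\<forall>\<^sub>F t in at s within {0..}. 0 < t"
      using \<open>0 < s\<close> by (intro order_tendstoD(1)[OF tendsto_ident_at])
    then have ev: "\<forall>\<^sub>F t in at s within {0..}.
        min 1 (t / s) * ?g s \<le> ?g t \<and> ?g t \<le> max 1 (t / s) * ?g s"
      by eventually_elim (rule bounds)
    show ?thesis
      by (rule tendsto_sandwich[OF _ _ lo hi]) (use ev in \<open>auto elim: eventually_mono\<close>)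
  qed
  have "strict_mono_on {0..} ?g"
  proof (rule strict_mono_onI)
    fix s t :: real assume "s \<in> {0..}" "s < t"
    then have "0 < c * (t - s)" "?g s + c * (t - s) \<le> ?g t"
      using \<open>0 < c\<close> by (simp, intro incr) auto
    then show "?g s < ?g t"
      by linarith
  qed
  moreover have "continuous_on {0..} ?g"
    unfolding continuous_on_def using cont by simp
  moreover have "?g ` {0..} \<subseteq> {0..}"
    using g_nonneg by (simp add: image_subset_iff)
  ultimately show ?thesis
    using zero unfolding index_function_def by blast
qed

section \<open>Closure properties of index functions\<close>

lemma index_function_compose:
  assumes f: "index_function f" and g: "index_function g"
  shows "index_function (\<lambda>t. f (g t))"
proof -
  have f_in: "f ` {0..} \<subseteq> {0..}" and g_in: "g ` {0..} \<subseteq> {0..}"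
    using f g by (simp_all add: index_function_def)
  have "continuous_on {0..} (\<lambda>t. f (g t))"
    by (rule continuous_on_compose2[OF _ _ g_in]) (use f g in \<open>simp_all add: index_function_def\<close>)
  moreover have "strict_mono_on {0..} (\<lambda>t. f (g t))"
  proof (rule strict_mono_onI)
    fix s t :: real assume st: "s \<in> {0..}" "t \<in> {0..}" "s < t"
    then have "g s < g t"
      using g by (simp add: index_function_def strict_mono_on_def)
    moreover have "g s \<in> {0..}" "g t \<in> {0..}"
      using st g_in by blast+
    ultimately show "f (g s) < f (g t)"
      using f by (simp add: index_function_def strict_mono_on_def)
  qed
  moreover have "(\<lambda>t. f (g t)) ` {0..} \<subseteq> {0..}"
    using f_in g_in by blast
  moreover have "f (g 0) = 0"
    using f g by (simp add: index_function_def)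
  ultimately show ?thesis
    unfolding index_function_def by blast
qed

lemma index_function_sqrt: "index_function sqrt"
  by (auto simp: index_function_def strict_mono_on_def intro: continuous_on_real_sqrt)

lemma index_function_cmult: "0 < c \<Longrightarrow> index_function (\<lambda>t. c * t)"
  by (auto simp: index_function_def strict_mono_on_def intro: continuous_on_mult_left)

text \<open>Lets a function that is prescribed only for t \<ge> 0, as \<phi> is in the theorem, be
  replaced by an explicit formula.\<close>

lemma index_function_cong:
  assumes "\<And>t. 0 \<le> t \<Longrightarrow> f t = g t"
  shows "index_function f \<longleftrightarrow> index_function g"
proof -
  have "f ` {0..} = g ` {0..}" "continuous_on {0..} f \<longleftrightarrow> continuous_on {0..} g"
    using assms by (auto intro!: image_cong continuous_on_cong)
  then show ?thesis
    using assms by (simp add: index_function_def strict_mono_on_def)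
qed

section \<open>Seminorm estimates and the source condition\<close>

lemma seminorm_minus_commute:
  assumes "seminorm p"
  shows "p (x - y) = p (y - x)"
proof -
  have "p ((-1) *\<^sub>R (y - x)) = \<bar>-1\<bar> * p (y - x)"
    using assms unfolding seminorm_def by blast
  then show ?thesis by simp
qed

lemma seminorm_diff_le:
  assumes "seminorm p"
  shows "p (x - y) \<le> p x + p y"
proof -
  have "p (x + (-1) *\<^sub>R y) \<le> p x + p ((-1) *\<^sub>R y)"
    using assms unfolding seminorm_def by blast
  moreover have "p ((-1) *\<^sub>R y) = \<bar>-1\<bar> * p y"
    using assms unfolding seminorm_def by blast
  ultimately show ?thesis by simp
qed

text \<open>This is the origin of the factor 2 in \<phi>. With q the complement of p, p (x - y)
  appears once in norm = p + q and once in p y \<le> p x + p (x - y). Likewise q y appears once in q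
  (x - y) \<le> q x + q y and once in - p y = q y - norm y.\<close>

lemma norm_diff_le_seminorm_split:
  assumes p: "seminorm p" and q: "seminorm (compl_seminorm p)"
  shows "norm (x - y) \<le> norm x - norm y + 2 * (p (x - y) + compl_seminorm p y)"
proof -
  have "p (x + (y - x)) \<le> p x + p (y - x)"
    using p unfolding seminorm_def by blast
  then have "p y \<le> p x + p (x - y)"
    using seminorm_minus_commute[OF p, of x y] by simp
  then show ?thesis
    using seminorm_diff_le[OF q, of x y] by (simp add: compl_seminorm_def)
qed

theorem proposition3p1:
  fixes D :: "'a::banach set"
    and F :: "'a \<Rightarrow> 'b::banach"
    and f_dag :: 'a
    and p :: "nat \<Rightarrow> 'a \<Rightarrow> real"
    and \<nu> :: "nat \<Rightarrow> real"
    and \<phi> :: "real \<Rightarrow> real"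
  assumes "D \<noteq> {}"
    and "inj_on F D"
    and "continuous_on D F"
    and "\<not> continuous_on (F ` D) (inv_into D F)"
    and "f_dag \<in> D"
    and "\<And>n. seminorm (p n)"
    and "\<And>n. 0 < \<nu> n"
    and "incseq \<nu>"
    and "\<And>n. seminorm (compl_seminorm (p n))"
    and "(\<lambda>n. p n f_dag) \<longlonglongrightarrow> norm f_dag"
    and "\<And>n f1 f2. f1 \<in> D \<Longrightarrow> f2 \<in> D \<Longrightarrow> p n (f1 - f2) \<le> \<nu> n * norm (F f1 - F f2)"
    and "\<And>t. 0 \<le> t \<Longrightarrow> \<phi> t = 2 * (INF n\<in>{1..}. \<nu> n * sqrt t + compl_seminorm (p n) f_dag)"
  shows "index_function \<phi> \<and> variational_source_condition D F \<phi> f_dag"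
proof
  note p = assms(6) and \<nu>_pos = assms(7) and compl = assms(9) and lim = assms(10)
    and stab = assms(11) and \<phi> = assms(12)
  define a where "a n = compl_seminorm (p n) f_dag" for n
  have a_nonneg: "0 \<le> a n" for n
    using compl[of n] by (simp add: a_def seminorm_def)
  have "(\<lambda>n. norm f_dag - p n f_dag) \<longlonglongrightarrow> norm f_dag - norm f_dag"
    by (intro tendsto_intros lim)
  then have a_lim: "a \<longlonglongrightarrow> 0"
    by (simp add: a_def[abs_def] compl_seminorm_def)
  have small: "\<exists>n\<in>{1..}. a n < e" if "0 < e" for e
  proof -
    \<comment> \<open>The infimum starts at n = 1, so the witness must avoid 0; convergence supplies
      arbitrarily large ones.\<close>
    have "\<forall>\<^sub>F n in sequentially. a n < e \<and> 1 \<le> n"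
      by (intro eventually_conj order_tendstoD(2)[OF a_lim that] eventually_ge_at_top)
    then show ?thesis
      by (auto dest: eventually_happens)
  qed
  have "index_function (\<lambda>s. INF n\<in>{1..}. \<nu> n * s + a n)"
  proof (rule index_function_INF_affine)
    \<comment> \<open>The first term of the increasing positive sequence serves as the uniform slope
      bound c.\<close>
    show "\<nu> 0 \<le> \<nu> n" for n
      using \<open>incseq \<nu>\<close> by (simp add: incseqD)
  qed (use \<nu>_pos a_nonneg small in auto)
  \<comment> \<open>\<phi> is assembled as doubling after the affine infimum after the square
    root.\<close>
  from index_function_compose[OF this index_function_sqrt]
  have "index_function (\<lambda>t. INF n\<in>{1..}. \<nu> n * sqrt t + a n)" .
  from index_function_compose[OF index_function_cmult this, of 2]
  have "index_function (\<lambda>t. 2 * (INF n\<in>{1..}. \<nu> n * sqrt t + a n))"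
    by simp
  moreover have "\<phi> t = 2 * (INF n\<in>{1..}. \<nu> n * sqrt t + a n)" if "0 \<le> t" for t
    unfolding a_def using that by (rule \<phi>)
  ultimately show "index_function \<phi>"
    by (simp only: index_function_cong[of \<phi>])
  show "variational_source_condition D F \<phi> f_dag"
    unfolding variational_source_condition_def
  proof
    fix f assume "f \<in> D"
    let ?\<delta> = "norm (F f - F f_dag)"
    \<comment> \<open>Solving the claim for the infimum leaves a left side free of n, so it only has
      to be a lower bound for each n separately; there the square root cancels the square.\<close>
    have "(norm (f - f_dag) - (norm f - norm f_dag)) / 2
        \<le> (INF n\<in>{1..}. \<nu> n * sqrt (?\<delta>\<^sup>2) + compl_seminorm (p n) f_dag)"
    proof (rule cINF_greatest)
      fix n
      show "(norm (f - f_dag) - (norm f - norm f_dag)) / 2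
          \<le> \<nu> n * sqrt (?\<delta>\<^sup>2) + compl_seminorm (p n) f_dag"
        using norm_diff_le_seminorm_split[OF p[of n] compl[of n], of f f_dag]
          stab[OF \<open>f \<in> D\<close> \<open>f_dag \<in> D\<close>, of n] by simp
    qed simp
    then show "norm (f - f_dag) \<le> norm f - norm f_dag + \<phi> (?\<delta>\<^sup>2)"
      using \<phi>[of "?\<delta>\<^sup>2"] by simp
  qed
qed

end
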